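(* Let $g$ and $M>1$ be positive integers, let $n_g$ be the number of gapsets of genus $g$, and for integers $q,m$ let $\#\mathcal F(g,q,m)$ be the number of gapsets of genus $g$, depth $q$ and multiplicity $m$. Then, with $k=\left\lceil\frac{2g}{M+1}\right\rceil$, $$n_g\le \mathbf F^{(k)}_{g+1}+\sum_{m=2}^{M}\ \sum_{q=k+1}^{\left\lceil\frac{2g}{m}\right\rceil}\#\mathcal F(g,q,m).$$
   Context: A gapset is a finite set $G\subset\mathbb N$ (positive integers) such that whenever $z\in G$ and $z=x+y$ with $x,y\in\mathbb N$, then $x\in G$ or $y\in G$. Its genus is $\#G$, its multiplicity is $m(G)=\min\{s\in\mathbb N_0\setminus G: s\ne0\}$, its conductor is $c(G)=\min\{s\in\mathbb N_0: s+n\notin G\ \forall n\in\mathbb N_0\}$, and its depth is $\lceil c(G)/m(G)\rceil$. For an integer $k\ge1$, the $k$-generalized Fibonacci sequence is defined by $\mathbf F^{(k)}_1=1$, $\mathbf F^{(k)}_i=0$ for $i\in[-k+2,0]$, and $\mathbf F^{(k)}_n=\sum_{i=1}^k\mathbf F^{(k)}_{n-i}$ for $n\ge2$ (for $k=1$ this gives $\mathbf F^{(1)}_n=1$ for all $n\ge1$); equivalently $\mathbf F^{(k)}_{g+1}$ is the number of compositions of $g$ with all parts in $\{1,\dots,k\}$. *)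

theory Defs
  imports Complex_Main
begin

(* The gapset condition is about decompositions into positive integers; membership of 0 is
   excluded explicitly because the ambient type nat contains 0. *)
definition gapset :: "nat set \<Rightarrow> bool" where
  "gapset G \<longleftrightarrow> finite G \<and> 0 \<notin> G \<and>
     (\<forall>z\<in>G. \<forall>x y. 0 < x \<longrightarrow> 0 < y \<longrightarrow> z = x + y \<longrightarrow> x \<in> G \<or> y \<in> G)"

definition genus :: "nat set \<Rightarrow> nat" where
  "genus G = card G"

definition multiplicity :: "nat set \<Rightarrow> nat" where
  "multiplicity G = (LEAST s. s \<notin> G \<and> s \<noteq> 0)"

definition conductor :: "nat set \<Rightarrow> nat" where
  "conductor G = (LEAST s. \<forall>n. s + n \<notin> G)"

definition depth :: "nat set \<Rightarrow> nat" where
  "depth G = nat \<lceil>real (conductor G) / real (multiplicity G)\<rceil>"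

definition num_gapsets :: "nat \<Rightarrow> nat" where
  "num_gapsets g = card {G. gapset G \<and> genus G = g}"

definition num_gapsets_depth_mult :: "nat \<Rightarrow> nat \<Rightarrow> nat \<Rightarrow> nat" where
  "num_gapsets_depth_mult g q m =
     card {G. gapset G \<and> genus G = g \<and> depth G = q \<and> multiplicity G = m}"

(* The sequence is indexed by integers. It is only meant for indices from 2 - k on; the value 0
   below that range is a totalisation which the recursion for n \<ge> 2 never reaches. *)
function gen_fib :: "nat \<Rightarrow> int \<Rightarrow> nat" where
  "gen_fib k n =
     (if n \<le> 0 then 0 else if n = 1 then 1 else (\<Sum>i=1..k. gen_fib k (n - int i)))"
  by pat_completeness auto
termination
  by (relation "Wellfounded.measure (\<lambda>(k, n). nat n)") auto

declare gen_fib.simps [simp del]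

(* Elements of a gapset of genus g are below 2 g, so the sets counted above are finite and their
   cardinalities are not the default value 0. *)
lemma gapset_elem_less:
  assumes "gapset G" "z \<in> G"
  shows "z < 2 * genus G"
proof -
  have fin: "finite G" and z0: "z \<noteq> 0"
    using assms by (auto simp: gapset_def intro: gr0I)
  have "{1..<z} \<subseteq> (G - {z}) \<union> (\<lambda>x. z - x) ` (G - {z})"
  proof
    fix x assume x: "x \<in> {1..<z}"
    then have "0 < x" "0 < z - x" "z = x + (z - x)" by auto
    with assms have "x \<in> G \<or> z - x \<in> G" unfolding gapset_def by blast
    then show "x \<in> (G - {z}) \<union> (\<lambda>x. z - x) ` (G - {z})"
    proof
      assume "z - x \<in> G"
      then have "z - x \<in> G - {z}" "x = z - (z - x)" using x by auto
      then show ?thesis by blast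
    qed (use x in auto)
  qed
  then have "card {1..<z} \<le> card ((G - {z}) \<union> (\<lambda>x. z - x) ` (G - {z}))"
    using fin by (intro card_mono) auto
  also have "\<dots> \<le> card (G - {z}) + card ((\<lambda>x. z - x) ` (G - {z}))"
    by (rule card_Un_le)
  also have "\<dots> \<le> 2 * card (G - {z})"
    using card_image_le[of "G - {z}" "\<lambda>x. z - x"] fin by simp
  finally have "z - 1 \<le> 2 * (card G - 1)"
    using fin assms by simp
  moreover have "0 < card G"
    using fin assms by (auto simp: card_gt_0_iff)
  ultimately show ?thesis using z0 by (simp add: genus_def)
qed

lemma finite_gapsets: "finite {G. gapset G \<and> genus G = g}"
proof (rule finite_subset)
  show "{G. gapset G \<and> genus G = g} \<subseteq> Pow {..<2 * g}"
    using gapset_elem_less by auto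
qed simp

end

theory Submission
  imports Defs
begin

text \<open>
  A gapset \<open>G\<close> of multiplicity \<open>m\<close> is closed under subtracting \<open>m\<close> and contains no multiple of
  \<open>m\<close>, so it is determined by its Kunz coordinates, the number of its elements in each nonzero
  residue class modulo \<open>m\<close>. These are \<open>m - 1\<close> positive integers that sum to the genus \<open>g\<close> and are
  at most the depth: they form a composition of \<open>g\<close>. Hence at most \<open>F\<^sup>k\<^sub>g\<^sub>+\<^sub>1\<close> gapsets of genus \<open>g\<close>
  have depth at most \<open>k\<close>. As the conductor is at most \<open>2 g\<close>, a gapset of depth greater than
  \<open>k = \<lceil>2 g / (M + 1)\<rceil>\<close> has multiplicity at most \<open>M\<close> and is counted by the double sum.
\<close>

section \<open>Compositions with bounded parts and generalized Fibonacci numbers\<close>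

definition compositions :: "nat \<Rightarrow> nat \<Rightarrow> nat list set" where
  "compositions k n = {xs. set xs \<subseteq> {1..k} \<and> sum_list xs = n}"

lemma compositions_0: "compositions k 0 = {[]}"
proof -
  have "xs = []" if "set xs \<subseteq> {1..k}" "sum_list xs = 0" for xs :: "nat list"
    using that by (cases xs) auto
  then show ?thesis by (auto simp: compositions_def)
qed

lemma compositions_pos:
  assumes "n > 0"
  shows "compositions k n = (\<Union>i\<in>{i\<in>{1..k}. i \<le> n}. (#) i ` compositions k (n - i))"
    (is "?L = ?R")
proof
  show "?L \<subseteq> ?R"
  proof
    fix xs assume xs: "xs \<in> ?L"
    with assms obtain i ys where "xs = i # ys"
      by (cases xs) (auto simp: compositions_def)
    with xs show "xs \<in> ?R" by (auto simp: compositions_def)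
  qed
  show "?R \<subseteq> ?L" by (auto simp: compositions_def)
qed

lemma finite_compositions: "finite (compositions k n)"
proof (induction n rule: less_induct)
  case (less n)
  show ?case
  proof (cases "n = 0")
    case False
    have "finite (\<Union>i\<in>{i\<in>{1..k}. i \<le> n}. (#) i ` compositions k (n - i))"
      using less False by (intro finite_UN_I finite_imageI) auto
    then show ?thesis using False by (subst compositions_pos) simp_all
  qed (simp add: compositions_0)
qed

lemma gen_fib_nonpos: "n \<le> 0 \<Longrightarrow> gen_fib k n = 0"
  by (subst gen_fib.simps) simp

lemma gen_fib_1: "gen_fib k 1 = 1"
  by (subst gen_fib.simps) simp

lemma card_compositions: "card (compositions k n) = gen_fib k (int n + 1)"
proof (induction n rule: less_induct)
  case (less n)
  show ?case
  proof (cases "n = 0")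
    case True
    then show ?thesis by (simp add: compositions_0 gen_fib_1)
  next
    case False
    let ?I = "{i\<in>{1..k}. i \<le> n}"
    have "card (compositions k n) = (\<Sum>i\<in>?I. card ((#) i ` compositions k (n - i)))"
      using False by (subst compositions_pos, simp, intro card_UN_disjoint)
        (auto simp: finite_compositions)
    also have "\<dots> = (\<Sum>i\<in>?I. gen_fib k (int n + 1 - int i))"
    proof (rule sum.cong)
      fix i assume "i \<in> ?I"
      then show "card ((#) i ` compositions k (n - i)) = gen_fib k (int n + 1 - int i)"
        using less[of "n - i"] by (simp add: card_image algebra_simps)
    qed simp
    \<comment> \<open>First parts \<open>i > n\<close> may be added freely: their index is at most
      0, where \<open>gen_fib\<close> vanishes.\<close>
    also have "\<dots> = (\<Sum>i=1..k. gen_fib k (int n + 1 - int i))"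
      by (rule sum.mono_neutral_left) (auto intro!: gen_fib_nonpos)
    also have "\<dots> = gen_fib k (int n + 1)"
      using False by (subst gen_fib.simps[of k "int n + 1"]) simp
    finally show ?thesis .
  qed
qed

section \<open>Initial segments, multiplicity and conductor\<close>

lemma downclosed_nat_eq_lessThan_card:
  fixes J :: "nat set"
  assumes "finite J" and down: "\<And>j. Suc j \<in> J \<Longrightarrow> j \<in> J"
  shows "J = {..<card J}"
proof -
  have down_le: "i \<in> J" if "j \<in> J" "i \<le> j" for i j
    using that(2,1) by (induction rule: inc_induct) (auto intro: down)
  have ex: "\<exists>n. n \<notin> J"
    using assms(1) ex_new_if_finite infinite_UNIV_nat by blast
  define N where "N = (LEAST n. n \<notin> J)"
  have "N \<notin> J" "\<And>i. i < N \<Longrightarrow> i \<in> J"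
    using LeastI_ex[OF ex] not_less_Least unfolding N_def by blast+
  then have "J = {..<N}"
    using down_le by (auto simp: not_less[symmetric])
  then show ?thesis by simp
qed

lemma multiplicity_props:
  assumes "finite G"
  shows "multiplicity G \<notin> G" "multiplicity G > 0"
    and "\<And>x. 0 < x \<Longrightarrow> x < multiplicity G \<Longrightarrow> x \<in> G"
proof -
  have "\<exists>s. s \<notin> insert 0 G"
    using assms by (intro ex_new_if_finite) auto
  then have "\<exists>s. s \<notin> G \<and> s \<noteq> 0" by auto
  from LeastI_ex[OF this] show "multiplicity G \<notin> G" "multiplicity G > 0"
    by (auto simp: multiplicity_def)
  show "x \<in> G" if "0 < x" "x < multiplicity G" for x
    using not_less_Least[of x] that by (auto simp: multiplicity_def)
qed

lemma gapset_conductor: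
  assumes "gapset G"
  shows "x \<in> G \<Longrightarrow> x < conductor G" "conductor G \<le> 2 * genus G"
proof -
  have *: "\<forall>n. 2 * genus G + n \<notin> G"
    using gapset_elem_less[OF assms] by fastforce
  then have c: "\<forall>n. conductor G + n \<notin> G"
    unfolding conductor_def by (rule LeastI)
  show "x < conductor G" if "x \<in> G"
    using c that by (metis le_add_diff_inverse not_less)
  show "conductor G \<le> 2 * genus G"
    using * unfolding conductor_def by (rule Least_le)
qed

section \<open>Kunz coordinates of a gapset\<close>

definition kunz :: "nat set \<Rightarrow> nat \<Rightarrow> nat" where
  "kunz G i = card {j. i + j * multiplicity G \<in> G}"

definition kunz_list :: "nat set \<Rightarrow> nat list" where
  "kunz_list G = map (kunz G) [1..<multiplicity G]"

context
  fixes G :: "nat set" and m :: nat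
  assumes gapset: "gapset G"
  defines "m \<equiv> multiplicity G"
begin

lemma gapset_finite: "finite G"
  using gapset by (simp add: gapset_def)

lemma gapset_mult_pos: "m > 0"
  using multiplicity_props(2)[OF gapset_finite] by (simp add: m_def)

text \<open>The gapset condition for the decomposition into \<open>x\<close> and \<open>m\<close>,
  where \<open>m\<close> itself is never in \<open>G\<close>.\<close>

lemma gapset_minus_mult:
  assumes "x + m \<in> G" "x > 0"
  shows "x \<in> G"
proof -
  have "x \<in> G \<or> m \<in> G"
    using assms gapset gapset_mult_pos unfolding gapset_def by blast
  then show ?thesis
    using multiplicity_props(1)[OF gapset_finite] by (simp add: m_def)
qed

lemma gapset_not_multiple: "j * m \<notin> G"
proof (induction j)
  case 0
  then show ?case using gapset by (simp add: gapset_def)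
next
  case (Suc j)
  then show ?case
    using gapset_minus_mult[of "j * m"] multiplicity_props(1)[OF gapset_finite] gapset_mult_pos
    \<comment> \<open>\<open>gapset_minus_mult\<close> needs a positive remainder, so the multiple
      \<open>m\<close> itself is treated apart.\<close>
    by (cases "j = 0") (auto simp: m_def add.commute)
qed

lemma gapset_finite_class: "finite {j. i + j * m \<in> G}"
proof (rule finite_subset)
  have "j \<le> i + j * m" for j using gapset_mult_pos by (simp add: trans_le_add2)
  then show "{j. i + j * m \<in> G} \<subseteq> {..conductor G}"
    using gapset_conductor(1)[OF gapset] by (force intro: less_imp_le le_less_trans)
qed simp

text \<open>Closure under subtracting \<open>m\<close> makes the admissible \<open>j\<close> an
  initial segment, so its cardinality is the first \<open>j\<close> that fails. This turns the count
  in \<open>kunz\<close> into a membership test.\<close>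

lemma gapset_mem_iff_kunz:
  assumes "i > 0"
  shows "i + j * m \<in> G \<longleftrightarrow> j < kunz G i"
proof -
  have "{j. i + j * m \<in> G} = {..<kunz G i}"
    unfolding kunz_def m_def[symmetric]
  proof (rule downclosed_nat_eq_lessThan_card[OF gapset_finite_class])
    fix j assume "Suc j \<in> {j. i + j * m \<in> G}"
    then have "(i + j * m) + m \<in> G" by (simp add: algebra_simps)
    from gapset_minus_mult[OF this] show "j \<in> {j. i + j * m \<in> G}"
      using assms by simp
  qed
  then show ?thesis by auto
qed

lemma gapset_mem_iff_kunz_mod:
  "x \<in> G \<longleftrightarrow> x mod m \<noteq> 0 \<and> x div m < kunz G (x mod m)"
proof (cases "x mod m = 0")
  case True
  then show ?thesis using gapset_not_multiple[of "x div m"] by (simp add: mod_eq_0_iff_dvd)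
next
  case False
  then show ?thesis using gapset_mem_iff_kunz[of "x mod m" "x div m"] by simp
qed

lemma kunz_bounds:
  assumes "0 < i" "i < m"
  shows "1 \<le> kunz G i" "kunz G i \<le> depth G"
proof -
  \<comment> \<open>Positive numbers below the multiplicity lie in \<open>G\<close>, so every
    nonzero class contributes.\<close>
  have "i + 0 * m \<in> G"
    using multiplicity_props(3)[OF gapset_finite, of i] assms by (simp add: m_def)
  then have pos: "0 < kunz G i" using gapset_mem_iff_kunz[OF assms(1)] by blast
  then show "1 \<le> kunz G i" by simp
  \<comment> \<open>This is the largest element of \<open>G\<close> in the class of
    \<open>i\<close>. Being below the conductor, it forces
    \<open>kunz G i - 1 < conductor G / m\<close>, and rounding up absorbs the 1.\<close>
  have "i + (kunz G i - 1) * m \<in> G"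
    using pos gapset_mem_iff_kunz[OF assms(1)] by simp
  then have "(kunz G i - 1) * m < conductor G"
    using gapset_conductor(1)[OF gapset] by fastforce
  then have "real (kunz G i - 1) < real (conductor G) / real m"
    using gapset_mult_pos by (simp add: pos_less_divide_eq flip: of_nat_mult)
  then show "kunz G i \<le> depth G"
    unfolding depth_def m_def[symmetric] using pos by linarith
qed

text \<open>Division with remainder by \<open>m\<close> matches the elements of \<open>G\<close>
  with pairs of a nonzero residue and an index below its Kunz coordinate.\<close>

lemma sum_kunz: "(\<Sum>i=1..<m. kunz G i) = genus G"
proof -
  have "(\<Sum>i=1..<m. kunz G i) = card (SIGMA i:{1..<m}. {..<kunz G i})"
    by simp
  also have "\<dots> = card G"
  proof (rule bij_betw_same_card)
    show "bij_betw (\<lambda>(i, j). i + j * m) (SIGMA i:{1..<m}. {..<kunz G i}) G"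
    proof (rule bij_betw_byWitness[where f' = "\<lambda>x. (x mod m, x div m)"])
      show "(\<lambda>(i, j). i + j * m) ` (SIGMA i:{1..<m}. {..<kunz G i}) \<subseteq> G"
        using gapset_mem_iff_kunz by auto
      show "(\<lambda>x. (x mod m, x div m)) ` G \<subseteq> (SIGMA i:{1..<m}. {..<kunz G i})"
        using gapset_mem_iff_kunz_mod gapset_mult_pos by (auto simp: Suc_le_eq)
    qed auto
  qed
  finally show ?thesis by (simp add: genus_def)
qed

lemma kunz_list_in_compositions:
  assumes "depth G \<le> k"
  shows "kunz_list G \<in> compositions k (genus G)"
proof -
  have "set (kunz_list G) \<subseteq> {1..k}"
  proof
    fix x assume "x \<in> set (kunz_list G)"
    then obtain i where i: "0 < i" "i < m" and x: "x = kunz G i"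
      by (auto simp: kunz_list_def m_def Suc_le_eq)
    show "x \<in> {1..k}"
      using kunz_bounds[OF i] assms by (simp add: x)
  qed
  moreover have "sum_list (kunz_list G) = genus G"
    using sum_kunz by (simp add: kunz_list_def m_def interv_sum_list_conv_sum_set_nat)
  ultimately show ?thesis by (simp add: compositions_def)
qed

end

lemma inj_on_kunz_list: "inj_on kunz_list {G. gapset G}"
proof (rule inj_onI, clarify)
  fix G H assume G: "gapset G" and H: "gapset H" and eq: "kunz_list G = kunz_list H"
  let ?m = "multiplicity G"
  \<comment> \<open>The list has length \<open>multiplicity G - 1\<close>. Positivity is what lets
    this truncated difference determine the multiplicity.\<close>
  have "0 < ?m" "0 < multiplicity H"
    using G H by (auto intro: gapset_mult_pos)
  moreover have "?m - 1 = multiplicity H - 1"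
    using arg_cong[OF eq, of length] by (simp add: kunz_list_def)
  ultimately have m: "multiplicity H = ?m" by simp
  have k: "kunz G i = kunz H i" if "0 < i" "i < ?m" for i
    using eq that by (auto simp: kunz_list_def m)
  have "x \<in> G \<longleftrightarrow> x \<in> H" for x
    using gapset_mem_iff_kunz_mod[OF G, of x] gapset_mem_iff_kunz_mod[OF H, of x]
      k[of "x mod ?m"] \<open>0 < ?m\<close> by (auto simp: m)
  then show "G = H" by blast
qed

section \<open>Counting gapsets by depth\<close>

lemma card_gapsets_depth_le:
  "card {G. gapset G \<and> genus G = g \<and> depth G \<le> k} \<le> gen_fib k (int g + 1)"
proof -
  have "card {G. gapset G \<and> genus G = g \<and> depth G \<le> k} \<le> card (compositions k g)"
  proof (rule card_inj_on_le)
    show "inj_on kunz_list {G. gapset G \<and> genus G = g \<and> depth G \<le> k}"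
      by (rule inj_on_subset[OF inj_on_kunz_list]) blast
    show "kunz_list ` {G. gapset G \<and> genus G = g \<and> depth G \<le> k} \<subseteq> compositions k g"
      using kunz_list_in_compositions by blast
  qed (rule finite_compositions)
  then show ?thesis by (simp add: card_compositions)
qed

text \<open>Rests on the bound of the conductor by twice the genus. Taking \<open>r = M + 1\<close>
  yields the threshold \<open>k\<close>; taking \<open>r\<close> to be the multiplicity yields the
  upper limit for \<open>q\<close> in the double sum.\<close>

lemma gapset_depth_le:
  assumes "gapset G" "r \<le> multiplicity G" "r > 0"
  shows "depth G \<le> nat \<lceil>2 * real (genus G) / real r\<rceil>"
proof -
  have "real (conductor G) / real (multiplicity G) \<le> 2 * real (genus G) / real r"
    using gapset_conductor(2)[OF assms(1)] assms by (intro frac_le) auto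
  then show ?thesis
    unfolding depth_def by (intro nat_mono ceiling_mono)
qed

theorem theorem6p8:
  fixes g M k :: nat
  assumes "g > 0"
    and "M > 1"
    and "k = nat \<lceil>2 * real g / (real M + 1)\<rceil>"
  shows "num_gapsets g \<le> gen_fib k (int g + 1) +
    (\<Sum>m = 2..M. \<Sum>q = k + 1..nat \<lceil>2 * real g / real m\<rceil>. num_gapsets_depth_mult g q m)"
proof -
  let ?A = "{G. gapset G \<and> genus G = g \<and> depth G \<le> k}"
  let ?B = "\<lambda>m q. {G. gapset G \<and> genus G = g \<and> depth G = q \<and> multiplicity G = m}"
  let ?Q = "\<lambda>m. {k + 1..nat \<lceil>2 * real g / real m\<rceil>}"
  let ?U = "\<Union>m\<in>{2..M}. \<Union>q\<in>?Q m. ?B m q"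
  have "{G. gapset G \<and> genus G = g} \<subseteq> ?A \<union> ?U"
  proof
    fix G assume "G \<in> {G. gapset G \<and> genus G = g}"
    then have G: "gapset G" "genus G = g" by auto
    let ?m = "multiplicity G"
    show "G \<in> ?A \<union> ?U"
    proof (cases "depth G \<le> k")
      case False
      have "?m \<le> M"
      proof (rule ccontr)
        assume "\<not> ?m \<le> M"
        then show False
          using gapset_depth_le[OF G(1), of "M + 1"] False assms(3) G(2) by (simp add: add.commute)
      qed
      \<comment> \<open>With multiplicity 1 there are no nonzero classes, so the sum of the Kunz
        coordinates is empty and the genus would be 0, against \<open>g > 0\<close>.\<close>
      moreover have "?m \<noteq> 1"
        using sum_kunz[OF G(1)] G(2) assms(1) by auto
      then have "2 \<le> ?m" using gapset_mult_pos[OF G(1)] by simp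
      moreover have "depth G \<le> nat \<lceil>2 * real g / real ?m\<rceil>"
        using gapset_depth_le[OF G(1), of ?m] gapset_mult_pos[OF G(1)] G(2) by simp
      ultimately have "G \<in> ?U" using False G by simp
      then show ?thesis ..
    qed (use G in simp)
  qed
  moreover have fin: "finite ?A" "finite (?B m q)" for m q
    by (rule finite_subset[OF _ finite_gapsets[of g]], blast)+
  ultimately have "num_gapsets g \<le> card (?A \<union> ?U)"
    unfolding num_gapsets_def by (intro card_mono) auto
  also have "\<dots> \<le> card ?A + card ?U"
    by (rule card_Un_le)
  also have "card ?U \<le> (\<Sum>m=2..M. card (\<Union>q\<in>?Q m. ?B m q))"
    by (rule card_UN_le) simp
  also have "\<dots> \<le> (\<Sum>m=2..M. \<Sum>q\<in>?Q m. num_gapsets_depth_mult g q m)"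
    unfolding num_gapsets_depth_mult_def by (intro sum_mono card_UN_le) simp
  finally show ?thesis
    using card_gapsets_depth_le[of g k] by simp
qed

end
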